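(* Let $X \in \mathbb{R}^{n\times p}$ with $\operatorname{rank} X = p$, let $\sigma>0$, $\epsilon \sim N_n(0,\sigma^2 I)$, and $y = X\beta^0 + \epsilon$ with $\beta^0 \in \mathbb{R}^p$. Let $\alpha \in (0,1)$. Then for any value of $\beta^0 \in \mathbb{R}^p$, the Lasso-Zero estimator with $(q,M)=(0,1)$ and threshold $\tau = \tau_\alpha^{\mathrm{QUT}}$ controls the family-wise error rate, and therefore the false discovery rate, at level $\alpha$: with $S^0 = \{j : \beta^0_j \neq 0\}$ and $\hat S = \{j : \hat\beta^{\mathrm{lass0}(0,1)}_{\tau,j} \ne 0\}$ for $\tau = \tau_\alpha^{\mathrm{QUT}}$, $$\mathrm{FWER} = \mathbb{P}\big(|\hat S \cap \overline{S^0}| > 0\big) \le \alpha \qquad\text{and}\qquad \mathrm{FDR} = \mathbb{E}\left(\frac{|\hat S \cap \overline{S^0}|}{|\hat S| \vee 1}\right) \le \alpha.$$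
   Context: The Lasso-Zero estimator with $(q,M)=(0,1)$ and threshold $\tau \ge 0$ is $\hat\beta^{\mathrm{lass0}(0,1)}_{\tau,j} := \eta_\tau(\hat\beta^{\ell_1}_j(y))$, $j=1,\dots,p$, where $\eta_\tau:\mathbb{R}\to\mathbb{R}$ is any thresholding function satisfying $\eta_\tau(x) = 0$ if $|x| \le \tau$ and $\operatorname{sign}(\eta_\tau(x)) = \operatorname{sign}(x)$ otherwise. In the present case $\operatorname{rank} X = p$, the unthresholded estimate is the least-squares estimate: $\hat\beta^{\ell_1}(v) = (X^TX)^{-1}X^T v$ for $v \in \mathbb{R}^n$. The $\alpha$-quantile universal threshold is $\tau_\alpha^{\mathrm{QUT}} := F_T^{-1}(1-\alpha)$, where $F_T$ is the cumulative distribution function of $T := \|\hat\beta^{\ell_1}(\epsilon)\|_\infty$ and $F_T^{-1}$ is its quantile function. $\overline{S}$ denotes the complement of $S$ in $\{1,\dots,p\}$. *)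

theory Defs
  imports "HOL-Probability.Probability"
begin

text \<open>Density of \<open>N_n(\<mu>, \<Sigma>)\<close> with respect to Lebesgue measure, for a symmetric positive
  definite covariance matrix \<open>\<Sigma>\<close>.\<close>

definition mvn_density :: "real^'n \<Rightarrow> real^'n^'n \<Rightarrow> real^'n \<Rightarrow> real" where
  "mvn_density \<mu> \<Sigma> x =
     exp (- ((x - \<mu>) \<bullet> (matrix_inv \<Sigma> *v (x - \<mu>))) / 2) / sqrt ((2 * pi) ^ CARD('n) * det \<Sigma>)"

definition mvn_distributed ::
    "'a measure \<Rightarrow> ('a \<Rightarrow> real^'n) \<Rightarrow> real^'n \<Rightarrow> real^'n^'n \<Rightarrow> bool" where
  "mvn_distributed M Z \<mu> \<Sigma> \<longleftrightarrow> distributed M lborel Z (\<lambda>x. ennreal (mvn_density \<mu> \<Sigma> x))"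

text \<open>Generalized inverse of the cumulative distribution function of the real distribution \<open>N\<close>;
  meaningful for \<open>0 < u < 1\<close> only.\<close>

definition quantile :: "real measure \<Rightarrow> real \<Rightarrow> real" where
  "quantile N u = Inf {x. u \<le> cdf N x}"

definition thresholding_function :: "real \<Rightarrow> (real \<Rightarrow> real) \<Rightarrow> bool" where
  "thresholding_function \<tau> h \<longleftrightarrow>
     (\<forall>x. (\<bar>x\<bar> \<le> \<tau> \<longrightarrow> h x = 0) \<and> (\<bar>x\<bar> > \<tau> \<longrightarrow> sgn (h x) = sgn x))"

text \<open>The unthresholded Lasso-Zero estimate for \<open>q = 0\<close>, \<open>M = 1\<close> and a design matrix of full
  column rank. Without full column rank \<open>X\<^sup>T X\<close> is singular and the value is meaningless.\<close>

definition l1_estimate :: "real^'p^'n \<Rightarrow> real^'n \<Rightarrow> real^'p" where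
  "l1_estimate X v = matrix_inv (transpose X ** X) *v (transpose X *v v)"

definition lass0_estimate ::
    "(real \<Rightarrow> real \<Rightarrow> real) \<Rightarrow> real \<Rightarrow> real^'p^'n \<Rightarrow> real^'n \<Rightarrow> real^'p" where
  "lass0_estimate \<eta> \<tau> X v = (\<chi> j. \<eta> \<tau> (l1_estimate X v $ j))"

definition qut :: "'a measure \<Rightarrow> ('a \<Rightarrow> real^'n) \<Rightarrow> real^'p^'n \<Rightarrow> real \<Rightarrow> real" where
  "qut M \<epsilon> X \<alpha> = quantile (distr M borel (\<lambda>\<omega>. infnorm (l1_estimate X (\<epsilon> \<omega>)))) (1 - \<alpha>)"

definition vec_support :: "real^'p \<Rightarrow> 'p set" where
  "vec_support b = {j. b $ j \<noteq> 0}"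

text \<open>Error rates of a random selected set \<open>\<omega> \<mapsto> S \<omega>\<close> when the set of true signals is \<open>S0\<close>.\<close>

definition fwer :: "'a measure \<Rightarrow> ('a \<Rightarrow> 'p::finite set) \<Rightarrow> 'p set \<Rightarrow> real" where
  "fwer M S S0 = measure M {\<omega> \<in> space M. card (S \<omega> \<inter> - S0) > 0}"

definition fdr :: "'a measure \<Rightarrow> ('a \<Rightarrow> 'p::finite set) \<Rightarrow> 'p set \<Rightarrow> real" where
  "fdr M S S0 = (\<integral>\<omega>. real (card (S \<omega> \<inter> - S0)) / real (max (card (S \<omega>)) 1) \<partial>M)"

end

theory Submission
  imports Defs
begin

text \<open>On a coordinate outside the support of \<open>\<beta>0\<close> the least-squares estimate from \<open>y\<close> coincides with
  the one from the noise \<open>\<epsilon>\<close>, so a false selection forces \<open>T = \<parallel>l1_estimate X \<epsilon>\<parallel>\<^sub>\<infinity>\<close> to exceed \<open>\<tau>\<close>.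
  As the cumulative distribution function of \<open>T\<close> is right-continuous, it is at least \<open>1 - \<alpha>\<close> at its
  quantile \<open>\<tau>\<close>, and \<open>T > \<tau>\<close> has probability at most \<open>\<alpha>\<close>. The false discovery proportion is at most
  the indicator of \<open>T > \<tau>\<close>.\<close>

text \<open>The limit 1 at infinity exceeds \<open>u\<close>, so \<open>cdf M\<close> does so
  somewhere. Only then does the infimum in \<open>quantile\<close> have set members arbitrarily
  close above it.\<close>

lemma (in real_distribution) cdf_superlevel_nonempty:
  assumes "u < 1"
  shows "{x. u \<le> cdf M x} \<noteq> {}"
proof -
  have "eventually (\<lambda>x. u < cdf M x) at_top"
    using order_tendstoD(1)[OF cdf_lim_at_top_prob assms] .
  then obtain c where "u < cdf M c"
    unfolding eventually_at_top_linorder by blast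
  then show ?thesis by (auto intro: less_imp_le)
qed

text \<open>Any point to the right of the infimum lies above a member of the superlevel set, so
  monotonicity gives the bound there; right-continuity carries it to the infimum itself.\<close>

lemma (in real_distribution) le_cdf_quantile:
  assumes "0 < u" "u < 1"
  shows "u \<le> cdf M (quantile M u)"
proof -
  define q where "q = quantile M u"
  have "u \<le> cdf M x" if "q < x" for x
  proof -
    obtain z where "u \<le> cdf M z" "z < x"
      using \<open>q < x\<close> cInf_lessD[OF cdf_superlevel_nonempty[OF assms(2)]]
      unfolding q_def quantile_def by blast
    then show ?thesis
      using cdf_nondecreasing[of z x] by linarith
  qed
  then have "eventually (\<lambda>x. u \<le> cdf M x) (at_right q)"
    by (auto simp: eventually_at_filter)
  moreover have "(cdf M \<longlongrightarrow> cdf M q) (at_right q)"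
    using cdf_is_right_cont[of q] by (simp add: continuous_within)
  ultimately show ?thesis
    unfolding q_def[symmetric] using tendsto_lowerbound trivial_limit_at_right_real by blast
qed

text \<open>A kernel vector \<open>v\<close> of the Gram matrix has squared norm of
  \<open>X *v v\<close> equal to 0, and full column rank makes \<open>X\<close> injective.\<close>

lemma invertible_transpose_mult_self:
  fixes X :: "real^'p^'n"
  assumes "rank X = CARD('p)"
  shows "invertible (transpose X ** X)"
proof -
  have inj: "inj ((*v) X)"
    using assms by (simp add: full_rank_injective)
  have "v = 0" if "(transpose X ** X) *v v = 0" for v
  proof -
    have "(X *v v) \<bullet> (X *v v) = ((transpose X ** X) *v v) \<bullet> v"
      by (simp add: dot_lmul_matrix[symmetric] matrix_vector_mul_assoc[symmetric] transpose_matrix_vector)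
    then have "X *v v = X *v 0"
      using that by simp
    then show "v = 0"
      using inj by (simp only: inj_eq)
  qed
  then show ?thesis
    unfolding invertible_left_inverse matrix_left_invertible_ker by blast
qed

lemma l1_estimate_affine:
  fixes X :: "real^'p^'n"
  assumes "rank X = CARD('p)"
  shows "l1_estimate X (X *v b + v) = b + l1_estimate X v"
proof -
  \<comment> \<open>\<open>matrix_inv\<close> is a Hilbert choice, so its inverse property rests on
    the invertibility just shown.\<close>
  have "matrix_inv (transpose X ** X) ** (transpose X ** X) = mat 1"
    using someI_ex[OF invertible_transpose_mult_self[OF assms, unfolded invertible_def]]
    by (simp add: matrix_inv_def)
  then have "matrix_inv (transpose X ** X) *v (transpose X *v (X *v b)) = b"
    by (simp add: matrix_vector_mul_assoc matrix_mul_assoc)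
  then show ?thesis
    by (simp add: l1_estimate_def matrix_vector_right_distrib)
qed

lemma continuous_infnorm_l1_estimate:
  "continuous_on UNIV (\<lambda>v. infnorm (l1_estimate X v))"
proof -
  have "continuous_on UNIV (\<lambda>v. l1_estimate X v)"
    unfolding l1_estimate_def
    by (intro matrix_vector_mult_linear_continuous_on continuous_on_compose2[OF matrix_vector_mult_linear_continuous_on]) auto
  then show ?thesis
    by (intro continuous_intros)
qed

text \<open>Off the support \<open>b $ j\<close> is 0, so coordinate \<open>j\<close> of the
  estimate is pure noise; surviving the threshold makes it exceed \<open>t\<close> in absolute
  value.\<close>

lemma lass0_estimate_false_selection:
  fixes X :: "real^'p^'n"
  assumes "rank X = CARD('p)" "thresholding_function t (\<eta> t)"
    and "j \<in> vec_support (lass0_estimate \<eta> t X (X *v b + v))" "j \<notin> vec_support b"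
  shows "t < infnorm (l1_estimate X v)"
proof -
  have "\<eta> t (l1_estimate X v $ j) \<noteq> 0"
    using assms(3,4) by (simp add: vec_support_def lass0_estimate_def l1_estimate_affine[OF assms(1)])
  then have "t < \<bar>l1_estimate X v $ j\<bar>"
    using assms(2) unfolding thresholding_function_def by (meson not_le)
  also have "\<dots> \<le> infnorm (l1_estimate X v)"
    by (rule component_le_infnorm_cart)
  finally show ?thesis .
qed

lemma (in prob_space) qut_bounds:
  fixes X :: "real^'p^'n"
  assumes eps [measurable]: "\<epsilon> \<in> borel_measurable M"
    and \<alpha>: "0 < \<alpha>" "\<alpha> < 1"
  shows "0 \<le> qut M \<epsilon> X \<alpha>"
    and "prob {\<omega> \<in> space M. qut M \<epsilon> X \<alpha> < infnorm (l1_estimate X (\<epsilon> \<omega>))} \<le> \<alpha>"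
proof -
  define T where "T = (\<lambda>\<omega>. infnorm (l1_estimate X (\<epsilon> \<omega>)))"
  have [measurable]: "T \<in> borel_measurable M"
    unfolding T_def
    using measurable_compose[OF eps borel_measurable_continuous_onI[OF continuous_infnorm_l1_estimate]] .
  interpret D: real_distribution "distr M borel T"
    by simp
  have cdf: "cdf (distr M borel T) x = prob {\<omega> \<in> space M. T \<omega> \<le> x}" for x
    by (simp add: cdf_def measure_distr vimage_def Int_def conj_commute)
  have qut: "qut M \<epsilon> X \<alpha> = quantile (distr M borel T) (1 - \<alpha>)"
    by (simp add: qut_def T_def)
  have le: "1 - \<alpha> \<le> prob {\<omega> \<in> space M. T \<omega> \<le> qut M \<epsilon> X \<alpha>}"
    using D.le_cdf_quantile[of "1 - \<alpha>"] \<alpha> unfolding cdf qut by simp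
  show "0 \<le> qut M \<epsilon> X \<alpha>"
  \<comment> \<open>A negative quantile would make
    \<open>T \<le> qut M \<epsilon> X \<alpha>\<close> impossible, yet that event has probability at
    least \<open>1 - \<alpha> > 0\<close>.\<close>
  proof (rule ccontr)
    assume "\<not> 0 \<le> qut M \<epsilon> X \<alpha>"
    moreover have "0 \<le> T \<omega>" for \<omega>
      by (simp add: T_def infnorm_pos_le)
    ultimately have empty: "{\<omega> \<in> space M. T \<omega> \<le> qut M \<epsilon> X \<alpha>} = {}"
      using order_trans by blast
    show False
      using le \<alpha> unfolding empty by simp
  qed
  have "prob {\<omega> \<in> space M. \<not> T \<omega> \<le> qut M \<epsilon> X \<alpha>} = 1 - prob {\<omega> \<in> space M. T \<omega> \<le> qut M \<epsilon> X \<alpha>}"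
    by (rule prob_neg) simp
  then show "prob {\<omega> \<in> space M. qut M \<epsilon> X \<alpha> < infnorm (l1_estimate X (\<epsilon> \<omega>))} \<le> \<alpha>"
    using le by (simp add: not_le T_def)
qed

lemma (in prob_space) fwer_le_prob:
  assumes "A \<in> events"
    and "\<And>\<omega>. \<omega> \<in> space M \<Longrightarrow> S \<omega> \<inter> - S0 \<noteq> {} \<Longrightarrow> \<omega> \<in> A"
  shows "fwer M S S0 \<le> prob A"
  unfolding fwer_def
  by (rule finite_measure_mono) (use assms in \<open>auto simp: card_gt_0_iff\<close>)

text \<open>The false discovery proportion is at most 1 and vanishes without false selections.
  Measurability is placed on the dominating event \<open>A\<close>, leaving \<open>S\<close>
  arbitrary.\<close>

lemma (in prob_space) fdr_le_prob:
  assumes A: "A \<in> events"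
    and sub: "\<And>\<omega>. \<omega> \<in> space M \<Longrightarrow> S \<omega> \<inter> - S0 \<noteq> {} \<Longrightarrow> \<omega> \<in> A"
  shows "fdr M S S0 \<le> prob A"
proof -
  have "fdr M S S0 \<le> (\<integral>\<omega>. indicator A \<omega> \<partial>M)"
    unfolding fdr_def
  proof (rule integral_mono')
    show "integrable M (indicat_real A)"
      using A by (simp add: integrable_indicator_iff less_top[symmetric])
    fix \<omega> assume \<omega>: "\<omega> \<in> space M"
    have "card (S \<omega> \<inter> - S0) \<le> card (S \<omega>)"
      by (rule card_mono) auto
    then show "real (card (S \<omega> \<inter> - S0)) / real (max (card (S \<omega>)) 1) \<le> indicat_real A \<omega>"
      using sub[OF \<omega>] by (cases "S \<omega> \<inter> - S0 = {}") (auto simp: divide_simps)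
  qed auto
  also have "\<dots> = prob A"
    using A by simp
  finally show ?thesis .
qed

theorem proposition2:
  fixes M :: "'a measure"
    and X :: "real^'p^'n"
    and \<epsilon> y :: "'a \<Rightarrow> real^'n"
    and \<beta>0 :: "real^'p"
    and \<sigma> \<alpha> \<tau> :: real
    and \<eta> :: "real \<Rightarrow> real \<Rightarrow> real"
    and S0 :: "'p set"
    and Shat :: "'a \<Rightarrow> 'p set"
  assumes "prob_space M"
    and "rank X = CARD('p)"
    and "\<sigma> > 0"
    and "mvn_distributed M \<epsilon> 0 (\<sigma>\<^sup>2 *\<^sub>R mat 1)"
    and "y = (\<lambda>\<omega>. X *v \<beta>0 + \<epsilon> \<omega>)"
    and "0 < \<alpha>" and "\<alpha> < 1"
    and "\<And>t. t \<ge> 0 \<Longrightarrow> thresholding_function t (\<eta> t)"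
    and "\<tau> = qut M \<epsilon> X \<alpha>"
    and "S0 = vec_support \<beta>0"
    and "Shat = (\<lambda>\<omega>. vec_support (lass0_estimate \<eta> \<tau> X (y \<omega>)))"
  shows "fwer M Shat S0 \<le> \<alpha> \<and> fdr M Shat S0 \<le> \<alpha>"
proof -
  interpret prob_space M by fact
  have eps [measurable]: "\<epsilon> \<in> borel_measurable M"
    using assms(4) distributed_measurable unfolding mvn_distributed_def by fastforce
  have [measurable]: "(\<lambda>\<omega>. infnorm (l1_estimate X (\<epsilon> \<omega>))) \<in> borel_measurable M"
    using measurable_compose[OF eps borel_measurable_continuous_onI[OF continuous_infnorm_l1_estimate]] .
  \<comment> \<open>One event bounds both error rates; it does not involve \<open>\<beta>0\<close>,
    hence the uniformity in the signal.\<close>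
  define A where "A = {\<omega> \<in> space M. \<tau> < infnorm (l1_estimate X (\<epsilon> \<omega>))}"
  have A: "A \<in> events"
    unfolding A_def by measurable
  \<comment> \<open>The assumption on \<open>\<eta>\<close> covers nonnegative thresholds, which is
    why the sign of the quantile matters.\<close>
  have "thresholding_function \<tau> (\<eta> \<tau>)"
    unfolding assms(9) by (rule assms(8)[OF qut_bounds(1)[OF eps assms(6,7)]])
  then have "\<omega> \<in> A" if "\<omega> \<in> space M" "Shat \<omega> \<inter> - S0 \<noteq> {}" for \<omega>
    using that lass0_estimate_false_selection[OF assms(2), of \<tau> \<eta> _ \<beta>0 "\<epsilon> \<omega>"]
    unfolding A_def assms(5,10,11) by blast
  moreover have "prob A \<le> \<alpha>"
    using qut_bounds(2)[OF eps assms(6,7)] unfolding A_def assms(9) .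
  ultimately show ?thesis
    using fwer_le_prob[OF A, of Shat S0] fdr_le_prob[OF A, of Shat S0] by force
qed

end
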